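(* Let $A=\mathbb K[x]$ and $B=\mathbb K[y]$. Let $S_n(t)\in\mathbb K[t]$ be defined by $S_1(t)=1$, $S_2(t)=1$, and $S_n(t)=S_{n-1}(t)-tS_{n-2}(t)$ for $n\ge 3$. Let $c\in\mathbb K$ be a root of $S_n(t)$ for some $n\ge 3$. Then there is no graded twisting map $\tau:B\otimes A\to A\otimes B$ such that $\tau(y\otimes x)=x^2\otimes 1_B+c\,1_A\otimes y^2$.
   Context: $\mathbb K$ is a field, $\otimes=\otimes_{\mathbb K}$; $x,y$ have degree $1$. $\mu_A$ is the multiplication of $A$; $1_A$ also denotes the identity map of $A$. Tensor products of graded spaces are graded by $(V\otimes W)_m=\bigoplus_{k+l=m}V_k\otimes W_l$; a linear map is graded if it preserves degree. A graded twisting map is a graded linear map $\tau:B\otimes A\to A\otimes B$ with $\tau(1_B\otimes a)=a\otimes 1_B$, $\tau(b\otimes 1_A)=1_A\otimes b$ for all $a\in A$, $b\in B$, and $\tau(\mu_B\otimes\mu_A)=(\mu_A\otimes\mu_B)(1_A\otimes\tau\otimes 1_B)(\tau\otimes\tau)(1_B\otimes\tau\otimes 1_A)$ on $B\otimes B\otimes A\otimes A$. *)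

theory Defs
  imports Complex_Main "HOL-Library.Poly_Mapping" "HOL-Computational_Algebra.Polynomial"
begin

section \<open>Vector spaces with a distinguished basis\<close>

text \<open>
  \<open>'i \<Rightarrow>\<^sub>0 'k\<close> is the \<open>'k\<close>-vector space with basis \<open>'i\<close>. If \<open>'i\<close> is a commutative monoid, the library makes it
  a ring under convolution, namely the monoid algebra of \<open>'i\<close>; in particular \<open>nat \<Rightarrow>\<^sub>0 'k\<close> is the
  polynomial ring in one variable.
\<close>

definition scale :: "'k::field \<Rightarrow> ('i \<Rightarrow>\<^sub>0 'k) \<Rightarrow> ('i \<Rightarrow>\<^sub>0 'k)" where
  "scale c p = Poly_Mapping.map ((*) c) p"

lemma lookup_scale [simp]: "Poly_Mapping.lookup (scale c p) i = c * Poly_Mapping.lookup p i"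
  by (simp add: scale_def map.rep_eq when_def)

lemma vector_space_scale: "vector_space (scale :: 'k::field \<Rightarrow> ('i \<Rightarrow>\<^sub>0 'k) \<Rightarrow> _)"
  by unfold_locales (auto intro!: poly_mapping_eqI simp: lookup_add algebra_simps)

lemma scale_single [simp]: "scale c (Poly_Mapping.single i a) = Poly_Mapping.single i (c * a)"
  by (rule poly_mapping_eqI) (simp add: lookup_single when_def)

definition linear_extension ::
  "('k::field \<Rightarrow> 'v::ab_group_add \<Rightarrow> 'v) \<Rightarrow> ('i \<Rightarrow> 'v) \<Rightarrow> ('i \<Rightarrow>\<^sub>0 'k) \<Rightarrow> 'v" where
  "linear_extension s g p = (\<Sum>i\<in>Poly_Mapping.keys p. s (Poly_Mapping.lookup p i) (g i))"

lemma linear_extension_superset: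
  assumes "vector_space s" "finite S" "Poly_Mapping.keys p \<subseteq> S"
  shows "linear_extension s g p = (\<Sum>i\<in>S. s (Poly_Mapping.lookup p i) (g i))"
proof -
  interpret vector_space s by fact
  show ?thesis unfolding linear_extension_def
    by (rule sum.mono_neutral_left) (use assms(2,3) in \<open>auto simp: in_keys_iff\<close>)
qed

lemma linear_linear_extension:
  fixes s :: "'k::field \<Rightarrow> 'v::ab_group_add \<Rightarrow> 'v" and g :: "'i \<Rightarrow> 'v"
  assumes "vector_space s"
  shows "Vector_Spaces.linear scale s (linear_extension s g)"
proof -
  interpret V: vector_space s by fact
  show ?thesis
    unfolding Vector_Spaces.linear_iff
  proof (intro conjI allI)
    fix p q :: "'i \<Rightarrow>\<^sub>0 'k" and c :: 'k
    let ?S = "Poly_Mapping.keys p \<union> Poly_Mapping.keys q"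
    have k: "Poly_Mapping.keys (p + q) \<subseteq> ?S" "Poly_Mapping.keys (scale c p) \<subseteq> ?S"
      by (auto simp: in_keys_iff lookup_add)
    show "linear_extension s g (p + q) = linear_extension s g p + linear_extension s g q"
      using k by (simp add: linear_extension_superset[OF assms, of ?S] lookup_add
          V.scale_left_distrib sum.distrib)
    show "linear_extension s g (scale c p) = s c (linear_extension s g p)"
      using k by (simp add: linear_extension_superset[OF assms, of ?S] V.scale_sum_right)
  qed (fact vector_space_scale, fact assms)
qed

lemma linear_extension_single:
  assumes "vector_space s"
  shows "linear_extension s g (Poly_Mapping.single i 1) = g i"
proof -
  interpret V: vector_space s by fact
  show ?thesis by (simp add: linear_extension_def)
qed

lemma expand_basis:
  "p = (\<Sum>i\<in>Poly_Mapping.keys p. scale (Poly_Mapping.lookup p i) (Poly_Mapping.single i 1))"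
  by (rule poly_mapping_eqI)
    (auto simp: lookup_sum lookup_single when_def in_keys_iff if_distrib cong: if_cong)

lemma linear_eq_on_basis:
  assumes "Vector_Spaces.linear scale s f" "Vector_Spaces.linear scale s g"
    and "\<And>i. f (Poly_Mapping.single i 1) = g (Poly_Mapping.single i 1)"
  shows "f = g"
proof
  fix p
  interpret F: Vector_Spaces.linear scale s f by fact
  interpret G: Vector_Spaces.linear scale s g by fact
  have "f (\<Sum>i\<in>Poly_Mapping.keys p. scale (Poly_Mapping.lookup p i) (Poly_Mapping.single i 1)) =
        g (\<Sum>i\<in>Poly_Mapping.keys p. scale (Poly_Mapping.lookup p i) (Poly_Mapping.single i 1))"
    unfolding F.sum G.sum F.scale G.scale assms(3) ..
  then show "f p = g p"
    by (simp only: expand_basis[symmetric])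
qed


section \<open>Tensor products\<close>

text \<open>
  The tensor product of the spaces with bases \<open>'i\<close> and \<open>'j\<close> is realised as the space with basis
  \<open>'i \<times> 'j\<close>. The lemmas \<open>bilinear_tensor\<close> and \<open>tensor_universal\<close> below show that it has the
  universal property that defines the tensor product.
\<close>

definition tensor :: "('i \<Rightarrow>\<^sub>0 'k::field) \<Rightarrow> ('j \<Rightarrow>\<^sub>0 'k) \<Rightarrow> ('i \<times> 'j \<Rightarrow>\<^sub>0 'k)" (infixr \<open>\<otimes>\<close> 75) where
  "v \<otimes> w = (\<Sum>i\<in>Poly_Mapping.keys v. \<Sum>j\<in>Poly_Mapping.keys w.
     Poly_Mapping.single (i, j) (Poly_Mapping.lookup v i * Poly_Mapping.lookup w j))"

definition bilinear_map ::
  "('k::field \<Rightarrow> 'u::ab_group_add \<Rightarrow> 'u) \<Rightarrow> ('k \<Rightarrow> 'v::ab_group_add \<Rightarrow> 'v) \<Rightarrow>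
   ('k \<Rightarrow> 'w::ab_group_add \<Rightarrow> 'w) \<Rightarrow> ('u \<Rightarrow> 'v \<Rightarrow> 'w) \<Rightarrow> bool" where
  "bilinear_map s1 s2 s3 h \<longleftrightarrow>
     (\<forall>u. Vector_Spaces.linear s2 s3 (h u)) \<and> (\<forall>v. Vector_Spaces.linear s1 s3 (\<lambda>u. h u v))"

definition tensor_lift ::
  "('k::field \<Rightarrow> 'v::ab_group_add \<Rightarrow> 'v) \<Rightarrow> (('i \<Rightarrow>\<^sub>0 'k) \<Rightarrow> ('j \<Rightarrow>\<^sub>0 'k) \<Rightarrow> 'v) \<Rightarrow>
   ('i \<times> 'j \<Rightarrow>\<^sub>0 'k) \<Rightarrow> 'v" where
  "tensor_lift s h =
     linear_extension s (\<lambda>(i, j). h (Poly_Mapping.single i 1) (Poly_Mapping.single j 1))"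

lemma lookup_tensor [simp]: "Poly_Mapping.lookup (v \<otimes> w) (i, j) = Poly_Mapping.lookup v i * Poly_Mapping.lookup w j"
proof -
  have "Poly_Mapping.lookup (v \<otimes> w) (i, j) =
      (\<Sum>i'\<in>Poly_Mapping.keys v. if i' = i then (\<Sum>j'\<in>Poly_Mapping.keys w.
         if j' = j then Poly_Mapping.lookup v i * Poly_Mapping.lookup w j else 0) else 0)"
    unfolding tensor_def lookup_sum lookup_single when_def
    by (intro sum.cong) auto
  also have "\<dots> = Poly_Mapping.lookup v i * Poly_Mapping.lookup w j"
    by (simp add: in_keys_iff)
  finally show ?thesis .
qed

lemma tensor_single [simp]:
  "Poly_Mapping.single i a \<otimes> Poly_Mapping.single j b = Poly_Mapping.single (i, j) (a * b)"
  by (rule poly_mapping_eqI) (auto simp: lookup_single when_def split_paired_all)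

lemma tensor_add_left: "(u + v) \<otimes> w = u \<otimes> w + v \<otimes> w"
  by (rule poly_mapping_eqI) (auto simp: lookup_add algebra_simps split_paired_all)

lemma tensor_add_right: "u \<otimes> (v + w) = u \<otimes> v + u \<otimes> w"
  by (rule poly_mapping_eqI) (auto simp: lookup_add algebra_simps split_paired_all)

lemma tensor_scale_left: "scale c v \<otimes> w = scale c (v \<otimes> w)"
  by (rule poly_mapping_eqI) (auto simp: algebra_simps split_paired_all)

lemma tensor_scale_right: "v \<otimes> scale c w = scale c (v \<otimes> w)"
  by (rule poly_mapping_eqI) (auto simp: algebra_simps split_paired_all)

lemma bilinear_tensor: "bilinear_map scale scale scale (\<otimes>)"
  unfolding bilinear_map_def Vector_Spaces.linear_iff
  by (simp add: vector_space_scale tensor_add_left tensor_add_right tensor_scale_left tensor_scale_right)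

lemma linear_tensor_lift:
  "vector_space s \<Longrightarrow> Vector_Spaces.linear scale s (tensor_lift s h)"
  unfolding tensor_lift_def by (rule linear_linear_extension)

lemma bilinear_eq_on_basis:
  assumes "bilinear_map scale scale s g" "bilinear_map scale scale s h"
    and "\<And>i j. g (Poly_Mapping.single i 1) (Poly_Mapping.single j 1) =
               h (Poly_Mapping.single i 1) (Poly_Mapping.single j 1)"
  shows "g = h"
proof -
  have "g (Poly_Mapping.single i 1) = h (Poly_Mapping.single i 1)" for i
    by (rule linear_eq_on_basis[where s = s]) (use assms in \<open>auto simp: bilinear_map_def\<close>)
  then have "(\<lambda>v. g v w) = (\<lambda>v. h v w)" for w
    by (intro linear_eq_on_basis[where s = s]) (use assms in \<open>auto simp: bilinear_map_def\<close>)
  then show ?thesis by (metis ext)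
qed

lemma tensor_lift_tensor:
  assumes "bilinear_map scale scale s h"
  shows "tensor_lift s h (v \<otimes> w) = h v w"
proof -
  have s: "vector_space s"
    using assms unfolding bilinear_map_def Vector_Spaces.linear_iff by blast
  have T: "Vector_Spaces.linear scale s (tensor_lift s h)"
    by (rule linear_tensor_lift[OF s])
  have "bilinear_map scale scale s (\<lambda>v w. tensor_lift s h (v \<otimes> w))"
    using T bilinear_tensor unfolding bilinear_map_def Vector_Spaces.linear_iff by metis
  then have "(\<lambda>v w. tensor_lift s h (v \<otimes> w)) = h"
    using assms by (rule bilinear_eq_on_basis) (simp add: tensor_lift_def linear_extension_single[OF s])
  then show ?thesis by metis
qed

theorem tensor_universal:
  fixes h :: "('i \<Rightarrow>\<^sub>0 'k::field) \<Rightarrow> ('j \<Rightarrow>\<^sub>0 'k) \<Rightarrow> 'v::ab_group_add"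
  assumes "bilinear_map scale scale s h"
  shows "\<exists>!f. Vector_Spaces.linear scale s f \<and> (\<forall>v w. f (v \<otimes> w) = h v w)"
proof (rule ex1I)
  have s: "vector_space s"
    using assms unfolding bilinear_map_def Vector_Spaces.linear_iff by blast
  show *: "Vector_Spaces.linear scale s (tensor_lift s h) \<and>
        (\<forall>v w. tensor_lift s h (v \<otimes> w) = h v w)"
    using linear_tensor_lift[OF s] tensor_lift_tensor[OF assms] by blast
  fix f assume f: "Vector_Spaces.linear scale s f \<and> (\<forall>v w. f (v \<otimes> w) = h v w)"
  show "f = tensor_lift s h"
  proof (rule linear_eq_on_basis)
    fix k :: "'i \<times> 'j"
    obtain i j where k: "k = (i, j)" by fastforce
    have "Poly_Mapping.single k (1::'k) = Poly_Mapping.single i 1 \<otimes> Poly_Mapping.single j 1"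
      by (simp add: k)
    then show "f (Poly_Mapping.single k 1) = tensor_lift s h (Poly_Mapping.single k 1)"
      using f * by metis
  qed (use f * in auto)
qed

definition tensor_map ::
  "(('i \<Rightarrow>\<^sub>0 'k::field) \<Rightarrow> ('i' \<Rightarrow>\<^sub>0 'k)) \<Rightarrow> (('j \<Rightarrow>\<^sub>0 'k) \<Rightarrow> ('j' \<Rightarrow>\<^sub>0 'k)) \<Rightarrow>
   ('i \<times> 'j \<Rightarrow>\<^sub>0 'k) \<Rightarrow> ('i' \<times> 'j' \<Rightarrow>\<^sub>0 'k)" where
  "tensor_map f g = tensor_lift scale (\<lambda>v w. f v \<otimes> g w)"

lemma tensor_map_tensor:
  assumes "Vector_Spaces.linear scale scale f" "Vector_Spaces.linear scale scale g"
  shows "tensor_map f g (v \<otimes> w) = f v \<otimes> g w"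
  unfolding tensor_map_def
  by (rule tensor_lift_tensor)
    (use assms in \<open>simp add: bilinear_map_def Vector_Spaces.linear_iff vector_space_scale tensor_add_left
      tensor_add_right tensor_scale_left tensor_scale_right\<close>)

text \<open>
  A fourfold tensor product is bracketed as \<open>(U \<otimes> V) \<otimes> (W \<otimes> X)\<close>. The next two maps are
  the canonical isomorphisms between it and \<open>U \<otimes> ((V \<otimes> W) \<otimes> X)\<close>.
\<close>

definition regroup :: "(('u \<times> 'v) \<times> ('w \<times> 'x) \<Rightarrow>\<^sub>0 'k::field) \<Rightarrow> ('u \<times> (('v \<times> 'w) \<times> 'x) \<Rightarrow>\<^sub>0 'k)" where
  "regroup = linear_extension scale (\<lambda>((a, b), (c, d)). Poly_Mapping.single (a, ((b, c), d)) 1)"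

definition ungroup :: "('u \<times> (('v \<times> 'w) \<times> 'x) \<Rightarrow>\<^sub>0 'k::field) \<Rightarrow> (('u \<times> 'v) \<times> ('w \<times> 'x) \<Rightarrow>\<^sub>0 'k)" where
  "ungroup = linear_extension scale (\<lambda>(a, ((b, c), d)). Poly_Mapping.single ((a, b), (c, d)) 1)"

lemma lookup_regroup: "Poly_Mapping.lookup (regroup p) (a, ((b, c), d)) = Poly_Mapping.lookup p ((a, b), (c, d))"
proof -
  have "Poly_Mapping.lookup (regroup p) (a, ((b, c), d)) =
      (\<Sum>k\<in>Poly_Mapping.keys p. if k = ((a, b), (c, d)) then Poly_Mapping.lookup p ((a, b), (c, d)) else 0)"
    unfolding regroup_def linear_extension_def lookup_sum
    by (intro sum.cong) (auto simp: lookup_single when_def split: prod.splits)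
  then show ?thesis by (simp add: in_keys_iff)
qed

lemma lookup_ungroup: "Poly_Mapping.lookup (ungroup p) ((a, b), (c, d)) = Poly_Mapping.lookup p (a, ((b, c), d))"
proof -
  have "Poly_Mapping.lookup (ungroup p) ((a, b), (c, d)) =
      (\<Sum>k\<in>Poly_Mapping.keys p. if k = (a, ((b, c), d)) then Poly_Mapping.lookup p (a, ((b, c), d)) else 0)"
    unfolding ungroup_def linear_extension_def lookup_sum
    by (intro sum.cong) (auto simp: lookup_single when_def split: prod.splits)
  then show ?thesis by (simp add: in_keys_iff)
qed

lemma regroup_tensor: "regroup ((u \<otimes> v) \<otimes> (w \<otimes> x)) = u \<otimes> ((v \<otimes> w) \<otimes> x)"
  by (rule poly_mapping_eqI) (auto simp: lookup_regroup mult.assoc split_paired_all)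

lemma ungroup_tensor: "ungroup (u \<otimes> ((v \<otimes> w) \<otimes> x)) = (u \<otimes> v) \<otimes> (w \<otimes> x)"
  by (rule poly_mapping_eqI) (auto simp: lookup_ungroup mult.assoc split_paired_all)

lemma ungroup_regroup [simp]: "ungroup (regroup p) = p"
  by (rule poly_mapping_eqI) (auto simp: lookup_regroup lookup_ungroup split_paired_all)

lemma regroup_ungroup [simp]: "regroup (ungroup p) = p"
  by (rule poly_mapping_eqI) (auto simp: lookup_regroup lookup_ungroup split_paired_all)

text \<open>\<open>1 \<otimes> f \<otimes> 1\<close>\<close>

definition middle_map ::
  "(('v \<times> 'w \<Rightarrow>\<^sub>0 'k::field) \<Rightarrow> ('v' \<times> 'w' \<Rightarrow>\<^sub>0 'k)) \<Rightarrow>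
   (('u \<times> 'v) \<times> ('w \<times> 'x) \<Rightarrow>\<^sub>0 'k) \<Rightarrow> (('u \<times> 'v') \<times> ('w' \<times> 'x) \<Rightarrow>\<^sub>0 'k)" where
  "middle_map f = ungroup \<circ> tensor_map id (tensor_map f id) \<circ> regroup"

lemma linear_id: "Vector_Spaces.linear scale scale (id :: ('i \<Rightarrow>\<^sub>0 'k::field) \<Rightarrow> _)"
  by (simp add: Vector_Spaces.linear_iff vector_space_scale)

lemma linear_tensor_map: "Vector_Spaces.linear scale scale (tensor_map f g)"
  unfolding tensor_map_def by (rule linear_tensor_lift[OF vector_space_scale])

lemma middle_map_tensor:
  assumes "Vector_Spaces.linear scale scale f"
  shows "middle_map f ((u \<otimes> v) \<otimes> (w \<otimes> x)) = ungroup (u \<otimes> (f (v \<otimes> w) \<otimes> x))"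
  by (simp add: middle_map_def regroup_tensor tensor_map_tensor linear_id linear_tensor_map assms)

definition mult_map :: "('i \<times> 'i \<Rightarrow>\<^sub>0 'k::field) \<Rightarrow> ('i::comm_monoid_add \<Rightarrow>\<^sub>0 'k)" where
  "mult_map = tensor_lift scale (*)"

lemma scale_conv_mult:
  "scale c p = Poly_Mapping.single 0 c * (p :: 'i::comm_monoid_add \<Rightarrow>\<^sub>0 'k::field)"
  unfolding scale_def by (rule mult_map_scale_conv_mult)

lemma bilinear_mult:
  "bilinear_map scale scale scale ((*) :: ('i::comm_monoid_add \<Rightarrow>\<^sub>0 'k::field) \<Rightarrow> _)"
  unfolding bilinear_map_def Vector_Spaces.linear_iff
  by (auto simp: vector_space_scale scale_conv_mult algebra_simps)

lemma mult_map_tensor: "mult_map (v \<otimes> w) = v * w"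
  unfolding mult_map_def by (rule tensor_lift_tensor[OF bilinear_mult])


section \<open>Gradings and twisting maps\<close>

text \<open>
  A grading is given by its family of homogeneous components. In \<open>graded_twisting_map A B\<close> the
  algebras are the rings \<open>'i \<Rightarrow>\<^sub>0 'k\<close> and \<open>'j \<Rightarrow>\<^sub>0 'k\<close>, and \<open>A\<close>, \<open>B\<close> are their gradings.
\<close>

definition tensor_grading ::
  "(nat \<Rightarrow> ('i \<Rightarrow>\<^sub>0 'k::field) set) \<Rightarrow> (nat \<Rightarrow> ('j \<Rightarrow>\<^sub>0 'k) set) \<Rightarrow> nat \<Rightarrow> ('i \<times> 'j \<Rightarrow>\<^sub>0 'k) set" where
  "tensor_grading V W m =
     module.span scale {v \<otimes> w | v w k l. k + l = m \<and> v \<in> V k \<and> w \<in> W l}"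

definition graded_linear ::
  "(nat \<Rightarrow> ('i \<Rightarrow>\<^sub>0 'k::field) set) \<Rightarrow> (nat \<Rightarrow> ('j \<Rightarrow>\<^sub>0 'k) set) \<Rightarrow>
   (('i \<Rightarrow>\<^sub>0 'k) \<Rightarrow> ('j \<Rightarrow>\<^sub>0 'k)) \<Rightarrow> bool" where
  "graded_linear V W f \<longleftrightarrow> Vector_Spaces.linear scale scale f \<and> (\<forall>m. f ` V m \<subseteq> W m)"

definition graded_twisting_map ::
  "(nat \<Rightarrow> ('i::comm_monoid_add \<Rightarrow>\<^sub>0 'k::field) set) \<Rightarrow> (nat \<Rightarrow> ('j::comm_monoid_add \<Rightarrow>\<^sub>0 'k) set) \<Rightarrow>
   (('j \<times> 'i \<Rightarrow>\<^sub>0 'k) \<Rightarrow> ('i \<times> 'j \<Rightarrow>\<^sub>0 'k)) \<Rightarrow> bool" where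
  "graded_twisting_map A B \<tau> \<longleftrightarrow>
     graded_linear (tensor_grading B A) (tensor_grading A B) \<tau> \<and>
     (\<forall>a. \<tau> (1 \<otimes> a) = a \<otimes> 1) \<and>
     (\<forall>b. \<tau> (b \<otimes> 1) = 1 \<otimes> b) \<and>
     \<tau> \<circ> tensor_map mult_map mult_map =
       tensor_map mult_map mult_map \<circ> middle_map \<tau> \<circ> tensor_map \<tau> \<tau> \<circ> middle_map \<tau>"


section \<open>The polynomial ring and the polynomials \<open>S\<^sub>n\<close>\<close>

text \<open>The variable of the polynomial ring, of degree 1\<close>

definition gen :: "nat \<Rightarrow>\<^sub>0 'k::field" where
  "gen = Poly_Mapping.single 1 1"

definition poly_grading :: "nat \<Rightarrow> (nat \<Rightarrow>\<^sub>0 'k::field) set" where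
  "poly_grading n = module.span scale {gen ^ n}"

lemma gen_power: "gen ^ n = Poly_Mapping.single n 1"
  by (induction n) (simp_all add: gen_def mult_single)

text \<open>The value at index \<open>0\<close> is irrelevant; the sequence starts at index \<open>1\<close>.\<close>

fun S :: "nat \<Rightarrow> 'k::field poly" where
  "S 0 = 0"
| "S (Suc 0) = 1"
| "S (Suc (Suc 0)) = 1"
| "S (Suc (Suc (Suc n))) = S (Suc (Suc n)) - [:0, 1:] * S (Suc n)"

end

theory Submission
  imports Defs
begin

text \<open>
  In the twisted tensor product put \<open>z\<^sub>k = y\<^sup>k x\<^bsup>n-k\<^esup>\<close>. The relation \<open>y x = x\<^sup>2 + c y\<^sup>2\<close> gives
  \<open>z\<^sub>k = z\<^bsub>k-1\<^esub> + c z\<^bsub>k+1\<^esub>\<close>, and eliminating from \<open>z\<^sub>0\<close> upwards gives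
  \<open>S\<^bsub>k+1\<^esub>(c) z\<^sub>k = z\<^sub>0 + c S\<^sub>k(c) z\<^bsub>k+1\<^esub>\<close>. If \<open>S\<^sub>n(c) = 0\<close>, then \<open>k = n - 1\<close> yields
  \<open>x\<^sup>n + c S\<^bsub>n-1\<^esub>(c) y\<^sup>n = 0\<close>, although \<open>x\<^sup>n\<close> and \<open>y\<^sup>n\<close> are linearly independent.
\<close>

lemma linear_mult_map: "Vector_Spaces.linear scale scale mult_map"
  unfolding mult_map_def by (rule linear_tensor_lift[OF vector_space_scale])

lemma linear_ungroup: "Vector_Spaces.linear scale scale ungroup"
  unfolding ungroup_def by (rule linear_linear_extension[OF vector_space_scale])

lemma linear_middle_map: "Vector_Spaces.linear scale scale (middle_map f)"
  unfolding middle_map_def regroup_def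
  by (intro Vector_Spaces.linear_compose[where ?s2.0 = scale] linear_linear_extension
      linear_tensor_map vector_space_scale linear_ungroup)

text \<open>
  Applying \<open>1 \<otimes> \<tau> \<otimes> 1\<close> to \<open>v \<otimes> b \<otimes> a \<otimes> w\<close> gives the same as applying it to
  \<open>v \<otimes> 1 \<otimes> a' \<otimes> w + c v \<otimes> b' \<otimes> 1 \<otimes> w\<close>, so the compatibility condition gives the claim
  without computing its remaining factors.
\<close>

lemma twisting_map_swap_middle:
  fixes \<tau> :: "('j::comm_monoid_add \<times> 'i::comm_monoid_add \<Rightarrow>\<^sub>0 'k::field) \<Rightarrow> ('i \<times> 'j \<Rightarrow>\<^sub>0 'k)"
  assumes \<tau>: "graded_twisting_map A B \<tau>"
    and ba: "\<tau> (b \<otimes> a) = a' \<otimes> 1 + scale c (1 \<otimes> b')"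
  shows "\<tau> ((v * b) \<otimes> (a * w)) = \<tau> (v \<otimes> (a' * w)) + scale c (\<tau> ((v * b') \<otimes> w))"
proof -
  define F where "F = tensor_map mult_map mult_map \<circ> middle_map \<tau> \<circ> tensor_map \<tau> \<tau>"
  define G where "G r = F (ungroup (v \<otimes> (r \<otimes> w)))" for r
  have lin: "Vector_Spaces.linear scale scale \<tau>"
    and one_l: "\<And>a. \<tau> (1 \<otimes> a) = a \<otimes> 1" and one_r: "\<And>b. \<tau> (b \<otimes> 1) = 1 \<otimes> b"
    and comp: "\<tau> \<circ> tensor_map mult_map mult_map = F \<circ> middle_map \<tau>"
    using \<tau> by (auto simp: graded_twisting_map_def graded_linear_def F_def)
  have key: "\<tau> ((v * p) \<otimes> (q * w)) = G (\<tau> (p \<otimes> q))" for p q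
    using fun_cong[OF comp, of "(v \<otimes> p) \<otimes> (q \<otimes> w)"]
    by (simp add: tensor_map_tensor linear_mult_map mult_map_tensor middle_map_tensor lin G_def)
  have lin_F: "Vector_Spaces.linear scale scale F"
    unfolding F_def
    by (intro Vector_Spaces.linear_compose[where ?s2.0 = scale] linear_tensor_map linear_middle_map)
  have G_add: "G (r + s) = G r + G s" and G_scale: "G (scale d r) = scale d (G r)" for r s d
    using lin_F
    by (simp_all add: G_def tensor_add_left tensor_add_right tensor_scale_left tensor_scale_right
        Vector_Spaces.linear_iff linear_ungroup[unfolded Vector_Spaces.linear_iff])
  have "\<tau> ((v * b) \<otimes> (a * w)) = G (a' \<otimes> 1) + scale c (G (1 \<otimes> b'))"
    by (simp only: key ba G_add G_scale)
  also have "G (a' \<otimes> 1) = \<tau> (v \<otimes> (a' * w))"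
    using key[of 1 a'] by (simp add: one_l)
  also have "G (1 \<otimes> b') = \<tau> ((v * b') \<otimes> w)"
    using key[of b' 1] by (simp add: one_r)
  finally show ?thesis .
qed

lemma tridiagonal_elimination:
  fixes z :: "nat \<Rightarrow> 'i \<Rightarrow>\<^sub>0 'k::field"
  assumes "\<And>k. Suc k < n \<Longrightarrow> z (Suc k) = z k + scale c (z (Suc (Suc k)))"
  shows "k < n \<Longrightarrow> scale (poly (S (Suc k)) c) (z k) = z 0 + scale (c * poly (S k) c) (z (Suc k))"
proof (induction k)
  case 0
  show ?case by (rule poly_mapping_eqI) (simp add: lookup_add)
next
  case (Suc k)
  \<comment> \<open>At \<open>k = 0\<close> this is not a defining equation of \<open>S\<close>: it
    holds because \<open>S 0 = 0\<close>, which also removes the \<open>z 1\<close> term in the base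
    case.\<close>
  have S_rec: "poly (S (Suc (Suc k))) c = poly (S (Suc k)) c - c * poly (S k) c"
    by (cases k) simp_all
  have z: "Poly_Mapping.lookup (z (Suc k)) i =
      Poly_Mapping.lookup (z k) i + c * Poly_Mapping.lookup (z (Suc (Suc k))) i" for i
    using assms[OF Suc.prems] by (simp add: lookup_add)
  have IH: "poly (S (Suc k)) c * Poly_Mapping.lookup (z k) i =
      Poly_Mapping.lookup (z 0) i + c * poly (S k) c * Poly_Mapping.lookup (z (Suc k)) i" for i
    using arg_cong[OF Suc.IH, of "\<lambda>p. Poly_Mapping.lookup p i"] Suc.prems by (simp add: lookup_add)
  show ?case
  proof (rule poly_mapping_eqI)
    fix i
    have "poly (S (Suc (Suc k))) c * Poly_Mapping.lookup (z (Suc k)) i =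
        Poly_Mapping.lookup (z 0) i + c * poly (S (Suc k)) c * Poly_Mapping.lookup (z (Suc (Suc k))) i"
      \<comment> \<open>Multiply \<open>z\<close> by \<open>S (Suc k)\<close> at \<open>c\<close>,
        replace the \<open>z k\<close> term by \<open>IH\<close>, and move the
        \<open>z (Suc k)\<close> term to the left, where \<open>S_rec\<close> combines the
        coefficients.\<close>
      using IH[of i] z[of i] unfolding S_rec by algebra
    then show "Poly_Mapping.lookup (scale (poly (S (Suc (Suc k))) c) (z (Suc k))) i =
        Poly_Mapping.lookup (z 0 + scale (c * poly (S (Suc k)) c) (z (Suc (Suc k)))) i"
      by (simp add: lookup_add)
  qed
qed

theorem proposition6p6:
  fixes c :: "'k::field" and n :: nat and x y :: "nat \<Rightarrow>\<^sub>0 'k"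
  assumes "x = gen" and "y = gen"
    and "n \<ge> 3" and "poly (S n) c = 0"
  shows "\<nexists>\<tau>. graded_twisting_map poly_grading poly_grading \<tau> \<and>
              \<tau> (y \<otimes> x) = x ^ 2 \<otimes> 1 + scale c (1 \<otimes> y ^ 2)"
proof
  assume "\<exists>\<tau>. graded_twisting_map poly_grading poly_grading \<tau> \<and>
              \<tau> (y \<otimes> x) = x ^ 2 \<otimes> 1 + scale c (1 \<otimes> y ^ 2)"
  then obtain \<tau> where \<tau>: "graded_twisting_map poly_grading poly_grading \<tau>"
    and yx: "\<tau> (y \<otimes> x) = x ^ 2 \<otimes> 1 + scale c (1 \<otimes> y ^ 2)" by blast
  define z where "z k = \<tau> (y ^ k \<otimes> x ^ (n - k))" for k
  have z_rec: "z (Suc k) = z k + scale c (z (Suc (Suc k)))" if k: "Suc k < n" for k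
  proof -
    \<comment> \<open>The exponent \<open>l\<close> is what remains of \<open>x\<close> after
      splitting off the middle \<open>y\<close> and \<open>x\<close>: \<open>z (Suc k)\<close> is
      the twist of \<open>(y ^ k * y) \<otimes> (x * x ^ l)\<close>.\<close>
    obtain l where n: "n = k + 2 + l"
      using k le_Suc_ex[of "k + 2" n] by auto
    show ?thesis
      using twisting_map_swap_middle[OF \<tau> yx, of "y ^ k" "x ^ l"]
      by (simp add: z_def n power2_eq_square mult_ac)
  qed
  obtain m where n: "n = Suc m"
    using \<open>n \<ge> 3\<close> by (cases n) auto
  have "scale (poly (S n) c) (z m) = z 0 + scale (c * poly (S m) c) (z n)"
    using tridiagonal_elimination[of n z c m] z_rec by (simp add: n)
  moreover have "z 0 = x ^ n \<otimes> 1" "z n = 1 \<otimes> y ^ n"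
    using \<tau> by (simp_all add: z_def graded_twisting_map_def)
  \<comment> \<open>At index \<open>(n, 0)\<close> the first summand has coefficient 1 and the
    second 0, since \<open>n > 0\<close>.\<close>
  ultimately have "0 = Poly_Mapping.lookup
      (x ^ n \<otimes> 1 + scale (c * poly (S m) c) (1 \<otimes> y ^ n)) (n, 0)"
    using \<open>poly (S n) c = 0\<close> by (metis lookup_scale mult_zero_left)
  then show False
    using \<open>n \<ge> 3\<close> by (simp add: \<open>x = gen\<close> gen_power lookup_add lookup_single lookup_one)
qed

end
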